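(* Let $k\geq 2$ be an integer. For every function $f\colon \mathbb{N}\to[0,\infty)$ with $f(n)=o(n^{3/2})$ there is a function $g\colon\mathbb{N}\to[0,\infty)$ with $g(n)=o(n)$ such that the following holds: every maximal $C_{2k+1}$-free graph $G$ on $n$ vertices with $e(G)\geq \frac{n^2}{4}-f(n)$ contains an induced complete bipartite subgraph on at least $n-g(n)$ vertices. (Informally: every maximal $C_{2k+1}$-free graph on $n$ vertices with at least $\frac{n^2}{4}-o(n^{3/2})$ edges contains an induced complete bipartite subgraph on $(1-o(1))n$ vertices.)
   Context: $C_{2k+1}$ denotes the cycle of length $2k+1$. A graph is $H$-free if it contains no subgraph isomorphic to $H$. A graph $G$ is maximal $H$-free if it is $H$-free and adding any edge of the complement of $G$ to $G$ creates a copy of $H$. $e(G)$ is the number of edges of $G$. All graphs are finite and simple. *)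

theory Defs
  imports Complex_Main "HOL-Library.Landau_Symbols"
begin

(* A graph is a pair (vertices, edges); an edge is the two-element set of its endpoints. *)
type_synonym 'a ugraph = "'a set \<times> 'a set set"

abbreviation verts :: "'a ugraph \<Rightarrow> 'a set" where
  "verts G \<equiv> fst G"

abbreviation edges :: "'a ugraph \<Rightarrow> 'a set set" where
  "edges G \<equiv> snd G"

definition simple_graph :: "'a ugraph \<Rightarrow> bool" where
  "simple_graph G \<longleftrightarrow> finite (verts G) \<and> (\<forall>e\<in>edges G. e \<subseteq> verts G \<and> card e = 2)"

definition subgraph_of :: "'a ugraph \<Rightarrow> 'a ugraph \<Rightarrow> bool" where
  "subgraph_of H G \<longleftrightarrow> simple_graph H \<and> verts H \<subseteq> verts G \<and> edges H \<subseteq> edges G"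

definition graph_iso :: "'a ugraph \<Rightarrow> 'b ugraph \<Rightarrow> bool" where
  "graph_iso G H \<longleftrightarrow>
     (\<exists>\<phi>. bij_betw \<phi> (verts G) (verts H) \<and> edges H = (\<lambda>e. \<phi> ` e) ` edges G)"

definition graph_free :: "'b ugraph \<Rightarrow> 'a ugraph \<Rightarrow> bool" where
  "graph_free H G \<longleftrightarrow> \<not> (\<exists>H'. subgraph_of H' G \<and> graph_iso H H')"

definition add_edge :: "'a \<Rightarrow> 'a \<Rightarrow> 'a ugraph \<Rightarrow> 'a ugraph" where
  "add_edge u v G = (verts G, insert {u, v} (edges G))"

definition maximal_free :: "'b ugraph \<Rightarrow> 'a ugraph \<Rightarrow> bool" where
  "maximal_free H G \<longleftrightarrow> graph_free H G \<and>
     (\<forall>u\<in>verts G. \<forall>v\<in>verts G. u \<noteq> v \<and> {u, v} \<notin> edges G \<longrightarrow> \<not> graph_free H (add_edge u v G))"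

(* The cycle of length m, meaningful for m \<ge> 3. *)
definition cycle_graph :: "nat \<Rightarrow> nat ugraph" where
  "cycle_graph m = ({..<m}, {{i, (i + 1) mod m} | i. i < m})"

definition induced_subgraph :: "'a ugraph \<Rightarrow> 'a set \<Rightarrow> 'a ugraph" where
  "induced_subgraph G W = (W, {e \<in> edges G. e \<subseteq> W})"

(* Parts may be empty: otherwise the one-vertex graph would contain no complete bipartite
   subgraph at all. *)
definition complete_bipartite :: "'a ugraph \<Rightarrow> bool" where
  "complete_bipartite G \<longleftrightarrow>
     (\<exists>A B. A \<inter> B = {} \<and> verts G = A \<union> B \<and> edges G = {{a, b} | a b. a \<in> A \<and> b \<in> B})"

end

theory Submission
  imports Defs
begin

text \<open>Deleting vertices of degree below \<open>9/20\<close> of the current order leaves a set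
  \<open>S\<close>; the excess of the degree sum over half the squared order grows with every deletion. High
  minimum degree forces \<open>S\<close> to be bipartite, with sides \<open>X\<close> and \<open>Y\<close>, so
  writing \<open>f n = t\<close> only \<open>O(t/n)\<close> vertices were deleted and only \<open>t\<close>
  pairs of \<open>X \<times> Y\<close> are missing. Vertices of \<open>S\<close> are joined by paths of every
  length at least 2 of the right parity. By maximality a missing pair \<open>x y\<close> is joined by a path
  of length \<open>2k\<close>, which leaves \<open>S\<close> by parity; unless both neighbours of its ends lie
  outside \<open>S\<close>, the part between the first exit and the last return is closed up to a cycle of
  length \<open>2k + 1\<close> by a path in \<open>S\<close>. So the path is \<open>x \<dots> r y\<close> with
  \<open>r\<close> outside \<open>S\<close>, and \<open>x\<close> is nonadjacent to almost all neighbours of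
  \<open>r\<close> in \<open>Y\<close>. Hence it suffices to discard the at most \<open>t/\<surd>n\<close>
  vertices of \<open>X\<close> with more than \<open>\<surd>n\<close> missing pairs, and for each
  \<open>r\<close> outside \<open>S\<close> its neighbourhood in \<open>Y\<close> if it has at most
  \<open>\<surd>n + O(k)\<close> elements.\<close>

section \<open>Degrees and elementary counting\<close>

definition nbrs :: "('a \<Rightarrow> 'a \<Rightarrow> bool) \<Rightarrow> 'a \<Rightarrow> 'a set \<Rightarrow> 'a set" where
  "nbrs E u S = {v \<in> S. E u v}"

definition degree_sum :: "('a \<Rightarrow> 'a \<Rightarrow> bool) \<Rightarrow> 'a set \<Rightarrow> nat" where
  "degree_sum E S = (\<Sum>u\<in>S. card (nbrs E u S))"

text \<open>The two sides are \<open>U \<inter> X\<close> and \<open>U - X\<close>.\<close>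

definition linked :: "('a \<Rightarrow> 'a \<Rightarrow> bool) \<Rightarrow> 'a set \<Rightarrow> 'a set \<Rightarrow> nat \<Rightarrow> bool" where
  "linked E U X s \<longleftrightarrow> (\<forall>u\<in>U. \<forall>u'\<in>U. (u \<in> X \<longleftrightarrow> u' \<in> X) \<longrightarrow>
     s < card {z \<in> U. (z \<in> X \<longleftrightarrow> u \<notin> X) \<and> E u z \<and> E u' z})"

lemma finite_nbrs [simp]: "finite S \<Longrightarrow> finite (nbrs E u S)"
  by (simp add: nbrs_def)

lemma nbrs_subset: "nbrs E u S \<subseteq> S"
  by (auto simp: nbrs_def)

lemma degree_sum_le: "finite S \<Longrightarrow> degree_sum E S \<le> card S * card S"
  unfolding degree_sum_def
  by (rule order_trans[OF sum_bounded_above[where K = "card S"]]) (simp_all add: card_mono nbrs_subset)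

lemma exists_not_in_set:
  assumes "card F < card A" "finite F"
  obtains a where "a \<in> A" "a \<notin> F"
  using assms by (metis card_mono not_le subsetI)

lemma card_le_by_markov:
  fixes h :: "'a \<Rightarrow> nat" and d :: real
  assumes "finite A" "0 \<le> d" "\<And>a. a \<in> D \<Longrightarrow> d \<le> real (h a)" "D \<subseteq> A"
  shows "real (card D) * d \<le> real (\<Sum>a\<in>A. h a)"
proof -
  have "real (card D) * d \<le> (\<Sum>a\<in>D. real (h a))"
    using sum_bounded_below[of D d "\<lambda>a. real (h a)"] assms(3) by simp
  also have "\<dots> \<le> (\<Sum>a\<in>A. real (h a))"
    using assms by (intro sum_mono2) auto
  finally show ?thesis by simp
qed

text \<open>A bare relation, with paths and cycles as distinct lists: concatenation splices paths,
  and no vertex set has to be carried along while vertices are deleted.\<close>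

locale odd_cycle_free =
  fixes E :: "'a \<Rightarrow> 'a \<Rightarrow> bool" and k :: nat
  assumes sym: "E u v \<Longrightarrow> E v u"
    and irrefl: "\<not> E u u"
    and k: "k \<ge> 2"
    and no_cycle: "\<lbrakk>distinct xs; length xs = 2 * k + 1; successively E xs; E (last xs) (hd xs)\<rbrakk> \<Longrightarrow> False"
begin

section \<open>Degree sums and sparse neighbourhoods\<close>

lemma degree_sum_remove:
  assumes "finite S" "w \<in> S"
  shows "degree_sum E S = degree_sum E (S - {w}) + 2 * card (nbrs E w S)"
proof -
  let ?T = "S - {w}"
  have dec: "card (nbrs E u S) = card (nbrs E u ?T) + (if E u w then 1 else 0)" for u
  proof (cases "E u w")
    case True
    then have "nbrs E u S = insert w (nbrs E u ?T)" using assms by (auto simp: nbrs_def)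
    moreover have "w \<notin> nbrs E u ?T" by (auto simp: nbrs_def)
    ultimately show ?thesis using assms True by simp
  next
    case False
    then have "nbrs E u S = nbrs E u ?T" by (auto simp: nbrs_def)
    then show ?thesis using False by simp
  qed
  have "(\<Sum>u\<in>?T. if E u w then 1 else 0) = card {u \<in> ?T. E u w}"
    using assms by (simp add: sum.If_cases Int_def)
  also have "{u \<in> ?T. E u w} = nbrs E w S"
    using sym irrefl by (auto simp: nbrs_def)
  finally have "(\<Sum>u\<in>?T. card (nbrs E u S)) = degree_sum E ?T + card (nbrs E w S)"
    by (simp add: dec sum.distrib degree_sum_def)
  moreover have "degree_sum E S = card (nbrs E w S) + (\<Sum>u\<in>?T. card (nbrs E u S))"
    unfolding degree_sum_def using assms by (rule sum.remove)
  ultimately show ?thesis by simp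
qed

text \<open>A path with fewer than \<open>d\<close> vertices cannot contain all neighbours of its
  head in \<open>T\<close>, so it grows greedily at the front.\<close>

lemma exists_path_of_min_degree:
  assumes "finite T" "T \<noteq> {}" "\<And>u. u \<in> T \<Longrightarrow> d \<le> card (nbrs E u T)" "l < d"
  shows "\<exists>xs. distinct xs \<and> length xs = Suc l \<and> set xs \<subseteq> T \<and> successively E xs"
  using \<open>l < d\<close>
proof (induction l)
  case 0
  obtain u where "u \<in> T" using assms by auto
  then show ?case by (intro exI[of _ "[u]"]) auto
next
  case (Suc l)
  then obtain xs where xs: "distinct xs" "length xs = Suc l" "set xs \<subseteq> T" "successively E xs" by auto
  then have "hd xs \<in> T" by (cases xs) auto
  then have "card (set xs) < card (nbrs E (hd xs) T)"
    using assms(3)[of "hd xs"] Suc.prems xs by (simp add: distinct_card)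
  then obtain v where "v \<in> nbrs E (hd xs) T" "v \<notin> set xs" by (rule exists_not_in_set) auto
  then show ?case using xs sym
    by (intro exI[of _ "v # xs"]) (auto simp: nbrs_def successively_Cons)
qed

text \<open>Otherwise \<open>T\<close> contains a path on \<open>2 * k\<close> vertices, which
  \<open>v\<close> closes to a cycle of length \<open>2 * k + 1\<close>.\<close>

lemma exists_low_degree_in_neighbourhood:
  assumes "finite T" "T \<noteq> {}" "\<And>u. u \<in> T \<Longrightarrow> E v u"
  shows "\<exists>w\<in>T. card (nbrs E w T) < 2 * k"
proof (rule ccontr)
  assume "\<not> ?thesis"
  then have "\<And>u. u \<in> T \<Longrightarrow> 2 * k \<le> card (nbrs E u T)" by force
  from exists_path_of_min_degree[OF assms(1,2) this, of "2 * k - 1"] k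
  obtain xs where xs: "distinct xs" "length xs = 2 * k" "set xs \<subseteq> T" "successively E xs"
    by (auto simp: Suc_diff_Suc)
  have ne: "xs \<noteq> []" using xs k by auto
  then have "E v (hd xs)" "E v (last xs)"
    using xs assms(3) by (meson hd_in_set last_in_set subsetD)+
  moreover have "v \<notin> set xs" using xs assms(3) irrefl by blast
  ultimately show False
    using no_cycle[of "v # xs"] xs ne sym by (auto simp: successively_Cons)
qed

text \<open>Degeneracy: as long as \<open>T\<close> is nonempty, some vertex can be removed at a
  cost of less than \<open>4 * k\<close> in the degree sum.\<close>

lemma degree_sum_neighbourhood:
  assumes "finite T" "\<And>u. u \<in> T \<Longrightarrow> E v u"
  shows "degree_sum E T \<le> 4 * k * card T"
  using assms
proof (induction "card T" arbitrary: T)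
  case 0
  then show ?case by (simp add: degree_sum_def)
next
  case (Suc c)
  then have "T \<noteq> {}" by auto
  then obtain w where w: "w \<in> T" "card (nbrs E w T) < 2 * k"
    using exists_low_degree_in_neighbourhood[of T v] Suc by auto
  have "degree_sum E (T - {w}) \<le> 4 * k * card (T - {w})"
    using Suc w by (intro Suc.hyps(1)) auto
  then have "degree_sum E T \<le> 4 * k * card (T - {w}) + 4 * k"
    using degree_sum_remove[OF Suc.prems(1) w(1)] w(2) by linarith
  also have "\<dots> = 4 * k * card T"
    using Suc w by (simp add: card_Diff_singleton flip: Suc.hyps(2))
  finally show ?case .
qed

section \<open>Paths of prescribed length in a linked set\<close>

text \<open>Induction on \<open>l\<close>: step from \<open>u\<close> to a fresh vertex on the other
  side and forbid \<open>u\<close>; at length 2 a common neighbour finishes.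
  \<open>card F + l\<close> does not grow, since \<open>F\<close> gains at most one element when
  \<open>l\<close> drops by one.\<close>

lemma exists_connecting_path:
  assumes lk: "linked E U X s" and "2 \<le> l" "finite F" "card F + l \<le> s"
    "u \<in> U" "w \<in> U" "u \<noteq> w" "(u \<in> X \<longleftrightarrow> w \<in> X) \<longleftrightarrow> even l"
  shows "\<exists>ps. distinct (u # ps @ [w]) \<and> length ps + 1 = l \<and> set ps \<inter> F = {} \<and> successively E (u # ps @ [w])"
  using assms(2-)
proof (induction l arbitrary: u F rule: dec_induct)
  case base
  have "s < card {z \<in> U. (z \<in> X \<longleftrightarrow> u \<notin> X) \<and> E u z \<and> E w z}"
    using lk base by (auto simp: linked_def)
  then have "card F < card {z \<in> U. (z \<in> X \<longleftrightarrow> u \<notin> X) \<and> E u z \<and> E w z}"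
    using base by linarith
  then obtain z where "E u z" "E w z" "z \<notin> F" by (rule exists_not_in_set) (use base in auto)
  then show ?case using base sym irrefl
    by (intro exI[of _ "[z]"]) auto
next
  case (step l)
  \<comment> \<open>With both vertices equal to \<open>u\<close>, \<open>linked\<close> is a lower
    bound on the degree of \<open>u\<close> to the other side.\<close>
  have "s < card {z \<in> U. (z \<in> X \<longleftrightarrow> u \<notin> X) \<and> E u z \<and> E u z}" (is "_ < card ?Z")
    using lk[unfolded linked_def, rule_format, OF step.prems(3,3)] by simp
  moreover have "card (insert u (insert w F)) \<le> card F + 2"
    using step.prems by (simp add: card_insert_if)
  ultimately have "card (insert u (insert w F)) < card ?Z"
    using step.prems step.hyps by linarith
  then obtain z where z: "z \<in> ?Z" "z \<notin> insert u (insert w F)"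
    by (rule exists_not_in_set) (use step.prems in simp)
  have "card (insert u F) + l \<le> s"
    using step.prems by (simp add: card_insert_if)
  then obtain ps where ps: "distinct (z # ps @ [w])" "length ps + 1 = l"
    "set ps \<inter> insert u F = {}" "successively E (z # ps @ [w])"
    using step.IH[of "insert u F" z] step.prems z by auto
  then show ?case using z step.prems
    by (intro exI[of _ "z # ps"]) auto
qed

text \<open>The walk from \<open>a\<close> through \<open>ms\<close> to \<open>b\<close> has
  \<open>length ms + 1\<close> edges, so a path with \<open>2 * k - length ms\<close> edges back to
  \<open>a\<close> completes the forbidden cycle. The conditions on \<open>ms\<close> say that this
  length is at least 2 and of the right parity.\<close>

lemma no_odd_closure:
  assumes lk: "linked E U X (4 * k + 1)"
    and ms: "distinct ms" "successively E ms" "ms \<noteq> []"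
    and ends: "a \<in> U" "b \<in> U" "a \<noteq> b" "E a (hd ms)" "E (last ms) b" "a \<notin> set ms" "b \<notin> set ms"
    and len: "length ms + 2 \<le> 2 * k" "(a \<in> X \<longleftrightarrow> b \<in> X) \<longleftrightarrow> even (length ms)"
  shows False
proof -
  let ?l = "2 * k - length ms"
  \<comment> \<open>The avoided set and the length are each at most \<open>2 * k\<close>, which
    \<open>4 * k + 1\<close> covers.\<close>
  have "card (set ms) \<le> 2 * k" using card_length[of ms] len by linarith
  then have "\<exists>ps. distinct (b # ps @ [a]) \<and> length ps + 1 = ?l \<and> set ps \<inter> set ms = {} \<and>
      successively E (b # ps @ [a])"
    using lk ends len by (intro exists_connecting_path[of U X "4 * k + 1"]) auto
  then obtain ps where ps: "distinct (b # ps @ [a])" "length ps + 1 = ?l" "set ps \<inter> set ms = {}"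
    "successively E (b # ps @ [a])" by blast
  show False
  proof (rule no_cycle[of "ms @ b # ps @ [a]"])
    show "distinct (ms @ b # ps @ [a])" using ps ms ends by auto
    show "length (ms @ b # ps @ [a]) = 2 * k + 1" using ps len by simp
    show "successively E (ms @ b # ps @ [a])"
      using ps ms ends by (simp add: successively_append_iff)
    show "E (last (ms @ b # ps @ [a])) (hd (ms @ b # ps @ [a]))" using ms ends by simp
  qed
qed


section \<open>High minimum degree forces a bipartition\<close>

text \<open>Two subsets of \<open>Q\<close> with more than \<open>(card Q + s) / 2\<close> elements
  each share more than \<open>s\<close>.\<close>

lemma linkedI:
  assumes "finite A" "finite B" "A \<inter> B = {}"
    and A: "\<And>u. u \<in> A \<Longrightarrow> card B + s < 2 * card (nbrs E u B)"
    and B: "\<And>u. u \<in> B \<Longrightarrow> card A + s < 2 * card (nbrs E u A)"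
  shows "linked E (A \<union> B) A s"
proof -
  have common: "s < card (nbrs E u Q \<inter> nbrs E u' Q)"
    if "finite Q" "card Q + s < 2 * card (nbrs E u Q)" "card Q + s < 2 * card (nbrs E u' Q)"
    for u u' Q
  proof -
    have "card (nbrs E u Q) + card (nbrs E u' Q) =
        card (nbrs E u Q \<union> nbrs E u' Q) + card (nbrs E u Q \<inter> nbrs E u' Q)"
      using that by (intro card_Un_Int) auto
    moreover have "card (nbrs E u Q \<union> nbrs E u' Q) \<le> card Q"
      using that by (intro card_mono) (auto simp: nbrs_def)
    ultimately show ?thesis using that by linarith
  qed
  show ?thesis
    unfolding linked_def
  proof (intro ballI impI)
    fix u u' assume u: "u \<in> A \<union> B" "u' \<in> A \<union> B" "(u \<in> A) = (u' \<in> A)"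
    show "s < card {z \<in> A \<union> B. (z \<in> A \<longleftrightarrow> u \<notin> A) \<and> E u z \<and> E u' z}"
    proof (cases "u \<in> A")
      case True
      then have "{z \<in> A \<union> B. (z \<in> A \<longleftrightarrow> u \<notin> A) \<and> E u z \<and> E u' z} = nbrs E u B \<inter> nbrs E u' B"
        using assms by (auto simp: nbrs_def)
      then show ?thesis using True u common[of B u u'] assms by auto
    next
      case False
      then have "{z \<in> A \<union> B. (z \<in> A \<longleftrightarrow> u \<notin> A) \<and> E u z \<and> E u' z} = nbrs E u A \<inter> nbrs E u' A"
        using assms by (auto simp: nbrs_def)
      then show ?thesis using False u common[of A u u'] assms by auto
    qed
  qed
qed

text \<open>Markov's inequality: the degree sum is at most \<open>4 * k * s\<close> and the
  threshold is \<open>s / 20\<close>, whence \<open>80 * k\<close>.\<close>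

lemma card_high_degree_in_neighbourhood:
  assumes "finite T" "\<And>u. u \<in> T \<Longrightarrow> E v u" "card T \<le> s" "s > 0"
  shows "card {a \<in> T. s < 20 * card (nbrs E a T)} \<le> 80 * k" (is "card ?D \<le> _")
proof -
  have "real (card ?D) * (real s / 20) \<le> real (\<Sum>a\<in>T. card (nbrs E a T))"
    using assms by (intro card_le_by_markov) auto
  also have "\<dots> \<le> real (4 * k * card T)"
    using degree_sum_neighbourhood[OF assms(1,2)] unfolding degree_sum_def by linarith
  also have "\<dots> \<le> real (4 * k * s)"
    using assms(3) by (intro of_nat_mono mult_le_mono) auto
  finally have "real (card ?D) * s \<le> real (80 * k) * s" by simp
  then have "real (card ?D) \<le> real (80 * k)" using assms(4) by (simp del: of_nat_mult)
  then show ?thesis by linarith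
qed

text \<open>Neighbourhoods are degenerate because they contain no path on \<open>2k\<close> vertices. So some \<open>w\<close>
  in the neighbourhood of \<open>v\<close> has almost no common neighbour with \<open>v\<close>, and the two neighbourhoods are
  the sides sought, up to the few vertices of large degree inside their own side.\<close>

lemma exists_linked_subset:
  assumes fin: "finite S" and mindeg: "\<And>u. u \<in> S \<Longrightarrow> 9 * card S \<le> 20 * card (nbrs E u S)"
    and large: "10000 * k \<le> card S"
  shows "\<exists>A B. A \<union> B \<subseteq> S \<and> linked E (A \<union> B) A (4 * k + 1) \<and>
    10 * card (S - (A \<union> B)) \<le> card S + 1620 * k"
proof -
  let ?s = "card S"
  have spos: "?s > 0" using large k by linarith
  then obtain v where v: "v \<in> S" by fastforce
  define A where "A = nbrs E v S"
  have A: "finite A" "A \<subseteq> S" "\<And>u. u \<in> A \<Longrightarrow> E v u" "9 * ?s \<le> 20 * card A"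
    using fin mindeg[OF v] by (auto simp: A_def nbrs_def)
  have "A \<noteq> {}" using A(4) spos by auto
  then obtain w where w: "w \<in> A" "card (nbrs E w A) < 2 * k"
    using exists_low_degree_in_neighbourhood[OF A(1) _ A(3)] by auto
  \<comment> \<open>Subtracting \<open>A\<close> makes the sides disjoint; by the choice of
    \<open>w\<close> it costs fewer than \<open>2 * k\<close> vertices.\<close>
  define B where "B = nbrs E w S - A"
  have B: "finite B" "B \<subseteq> S" "\<And>u. u \<in> B \<Longrightarrow> E w u" "A \<inter> B = {}"
    using fin by (auto simp: B_def nbrs_def)
  have "card (nbrs E w S) \<le> card (B \<union> nbrs E w A)"
    using fin by (intro card_mono) (auto simp: B_def A_def nbrs_def)
  also have "\<dots> \<le> card B + card (nbrs E w A)" by (rule card_Un_le)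
  finally have cB: "9 * ?s \<le> 20 * card B + 40 * k" using mindeg[of w] w A(2) by auto
  define A' where "A' = {a \<in> A. 20 * card (nbrs E a A) \<le> ?s}"
  define B' where "B' = {b \<in> B. 20 * card (nbrs E b B) \<le> ?s}"
  have sub: "A' \<subseteq> A" "B' \<subseteq> B" "finite A'" "finite B'" "A' \<inter> B' = {}"
    using A(1) B by (auto simp: A'_def B'_def)
  have "card A \<le> card (A' \<union> {a \<in> A. ?s < 20 * card (nbrs E a A)})"
    using A(1) by (intro card_mono) (auto simp: A'_def)
  also have "\<dots> \<le> card A' + card {a \<in> A. ?s < 20 * card (nbrs E a A)}" by (rule card_Un_le)
  finally have cA': "card A \<le> card A' + 80 * k"
    using card_high_degree_in_neighbourhood[OF A(1,3), of ?s] A(2) fin spos card_mono[OF fin A(2)]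
    by linarith
  have "card B \<le> card (B' \<union> {a \<in> B. ?s < 20 * card (nbrs E a B)})"
    using B(1) by (intro card_mono) (auto simp: B'_def)
  also have "\<dots> \<le> card B' + card {a \<in> B. ?s < 20 * card (nbrs E a B)}" by (rule card_Un_le)
  finally have cB': "card B \<le> card B' + 80 * k"
    using card_high_degree_in_neighbourhood[OF B(1,3), of ?s] B(2) fin spos card_mono[OF fin B(2)]
    by linarith
  define Z where "Z = S - (A' \<union> B')"
  have "card Z + card (A' \<union> B') = ?s"
    unfolding Z_def using sub A B fin
    by (subst card_Diff_subset) (auto intro!: le_add_diff_inverse2 card_mono)
  then have Z: "card Z + card A' + card B' = ?s" using sub by (simp add: card_Un_disjoint)
  \<comment> \<open>At most \<open>?s / 20\<close> neighbours of \<open>u\<close> lie in all of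
    \<open>A\<close>; the others lie in \<open>B'\<close> or in \<open>Z\<close>.\<close>
  have dA: "9 * ?s \<le> ?s + 20 * card (nbrs E u B') + 20 * card Z" if "u \<in> A'" for u
  proof -
    have "card (nbrs E u S) \<le> card (nbrs E u A \<union> nbrs E u B' \<union> Z)"
      using A sub fin by (intro card_mono) (auto simp: nbrs_def Z_def)
    also have "\<dots> \<le> card (nbrs E u A) + card (nbrs E u B') + card Z"
      using card_Un_le[of "nbrs E u A \<union> nbrs E u B'" Z] card_Un_le[of "nbrs E u A" "nbrs E u B'"]
      by linarith
    finally show ?thesis using that mindeg[of u] A(2) by (auto simp: A'_def)
  qed
  have dB: "9 * ?s \<le> ?s + 20 * card (nbrs E u A') + 20 * card Z" if "u \<in> B'" for u
  proof -
    have "card (nbrs E u S) \<le> card (nbrs E u B \<union> nbrs E u A' \<union> Z)"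
      using B sub fin by (intro card_mono) (auto simp: nbrs_def Z_def)
    also have "\<dots> \<le> card (nbrs E u B) + card (nbrs E u A') + card Z"
      using card_Un_le[of "nbrs E u B \<union> nbrs E u A'" Z] card_Un_le[of "nbrs E u B" "nbrs E u A'"]
      by linarith
    finally show ?thesis using that mindeg[of u] B(2) by (auto simp: B'_def)
  qed
  \<comment> \<open>A side has at most \<open>11 / 20 * ?s + 82 * k\<close> vertices, while twice a
    degree across is at least \<open>6 / 10 * ?s - 324 * k\<close>. The gap \<open>?s / 20\<close>
    beats the terms in \<open>k\<close> once \<open>?s \<ge> 10000 * k\<close>.\<close>
  have "linked E (A' \<union> B') A' (4 * k + 1)"
  proof (rule linkedI)
    fix u assume "u \<in> A'"
    from dA[OF this] show "card B' + (4 * k + 1) < 2 * card (nbrs E u B')"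
      using Z cA' cB' cB A(4) large k by linarith
  next
    fix u assume "u \<in> B'"
    from dB[OF this] show "card A' + (4 * k + 1) < 2 * card (nbrs E u A')"
      using Z cA' cB' cB A(4) large k by linarith
  qed (use sub in auto)
  moreover have "10 * card Z \<le> ?s + 1620 * k" using Z cA' cB' cB A(4) by linarith
  moreover have "A' \<union> B' \<subseteq> S" using sub(1,2) A(2) B(2) by auto
  ultimately show ?thesis unfolding Z_def by (intro exI[of _ A'] exI[of _ B'] conjI)
qed

text \<open>Every vertex of \<open>S\<close> sees only one side of \<open>?U\<close>: two neighbours
  on different sides would close up to a cycle through it. Sort the vertices by that side; an edge
  inside a class gives a path \<open>b\<close>, \<open>z\<close>, \<open>z'\<close>,
  \<open>b'\<close> with both ends on one side, which closes up as well.\<close>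

lemma bipartite_of_min_degree:
  assumes fin: "finite S" and mindeg: "\<And>u. u \<in> S \<Longrightarrow> 9 * card S \<le> 20 * card (nbrs E u S)"
    and large: "10000 * k \<le> card S"
  shows "\<exists>X\<subseteq>S. (\<forall>u\<in>X. \<forall>v\<in>X. \<not> E u v) \<and> (\<forall>u\<in>S - X. \<forall>v\<in>S - X. \<not> E u v)"
proof -
  obtain A B where AB: "A \<union> B \<subseteq> S" and lk: "linked E (A \<union> B) A (4 * k + 1)"
    and out: "10 * card (S - (A \<union> B)) \<le> card S + 1620 * k"
    using exists_linked_subset[OF assms] by blast
  let ?U = "A \<union> B"
  have same_side: "a \<in> A \<longleftrightarrow> b \<in> A" if "a \<in> ?U" "b \<in> ?U" "E z a" "E z b" for z a b
  proof (rule ccontr)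
    assume "(a \<in> A) \<noteq> (b \<in> A)"
    then show False
      using no_odd_closure[OF lk, of "[z]" a b] that sym irrefl k by auto
  qed
  \<comment> \<open>More than two neighbours in \<open>?U\<close> allow \<open>b\<close> and
    \<open>b'\<close> to be chosen distinct and off the edge.\<close>
  have many: "card {z, z'} < card (nbrs E u ?U)" if "u \<in> S" for u z z'
  proof -
    have "card (nbrs E u S) \<le> card (nbrs E u ?U \<union> (S - ?U))"
      using fin AB by (intro card_mono) (auto simp: nbrs_def intro: finite_subset)
    also have "\<dots> \<le> card (nbrs E u ?U) + card (S - ?U)" by (rule card_Un_le)
    finally have "2 < card (nbrs E u ?U)" using mindeg[OF that] out large k by linarith
    moreover have "card {z, z'} \<le> 2" by (simp add: card_insert_if)
    ultimately show ?thesis by linarith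
  qed
  define X where "X = {z \<in> S. nbrs E z A = {}}"
  have indep: "\<not> E z z'" if zz: "z \<in> S" "z' \<in> S" and X: "z \<in> X \<longleftrightarrow> z' \<in> X" for z z'
  proof
    assume e: "E z z'"
    obtain b where b: "b \<in> nbrs E z ?U" "b \<notin> {z', z'}" by (rule exists_not_in_set[OF many[OF zz(1)]]) auto
    obtain b' where b': "b' \<in> nbrs E z' ?U" "b' \<notin> {z, b}" by (rule exists_not_in_set[OF many[OF zz(2)]]) auto
    have "b \<in> A \<longleftrightarrow> z \<notin> X" using b zz same_side[of b _ z] by (auto simp: X_def nbrs_def)
    moreover have "b' \<in> A \<longleftrightarrow> z' \<notin> X" using b' zz same_side[of b' _ z'] by (auto simp: X_def nbrs_def)
    ultimately have "b \<in> A \<longleftrightarrow> b' \<in> A" using X by simp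
    \<comment> \<open>Here the middle part has two vertices, so closing it up requires
      \<open>4 \<le> 2 * k\<close>.\<close>
    then show False
      using no_odd_closure[OF lk, of "[z, z']" b b'] b b' e sym irrefl k by (auto simp: nbrs_def)
  qed
  have "X \<subseteq> S" by (auto simp: X_def)
  then show ?thesis using indep by (intro exI[of _ X]) blast
qed

section \<open>A large, nearly complete bipartite core\<close>

text \<open>Delete vertices of low degree one by one. A deletion from \<open>s\<close> vertices
  lowers the degree sum by less than \<open>9 / 10 * s\<close> and \<open>9 / 20 * s^2\<close> by
  \<open>9 / 10 * s - 9 / 20\<close>; the linear term \<open>s / 2\<close> makes up for the
  \<open>9 / 20\<close>, so the potential never decreases.\<close>

lemma exists_min_degree_subset:
  assumes "finite S"
  shows "\<exists>S'\<subseteq>S. (\<forall>u\<in>S'. 9 * card S' \<le> 20 * card (nbrs E u S')) \<and>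
    real (degree_sum E S) - 9 / 20 * (real (card S))\<^sup>2 - real (card S) / 2 \<le>
    real (degree_sum E S') - 9 / 20 * (real (card S'))\<^sup>2 - real (card S') / 2"
  using assms
proof (induction "card S" arbitrary: S)
  case 0
  then show ?case by (intro exI[of _ S]) auto
next
  case (Suc c)
  show ?case
  proof (cases "\<forall>u\<in>S. 9 * card S \<le> 20 * card (nbrs E u S)")
    case True
    then show ?thesis by (intro exI[of _ S]) auto
  next
    case False
    then obtain w where w: "w \<in> S" "20 * card (nbrs E w S) < 9 * card S" by force
    let ?T = "S - {w}"
    have cT: "c = card ?T" using Suc w by simp
    have "real (card S) = real c + 1" using Suc by linarith
    moreover have "real (degree_sum E S) = real (degree_sum E ?T) + 2 * real (card (nbrs E w S))"
      using degree_sum_remove[OF Suc.prems w(1)] by simp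
    moreover have "20 * real (card (nbrs E w S)) < 9 * real (card S)" using w(2) by linarith
    ultimately have
      "real (degree_sum E S) - 9 / 20 * (real (card S))\<^sup>2 - real (card S) / 2 \<le>
       real (degree_sum E ?T) - 9 / 20 * (real (card ?T))\<^sup>2 - real (card ?T) / 2"
      unfolding cT[symmetric] by (simp add: power2_eq_square field_simps)
    then show ?thesis using Suc.hyps(1)[OF cT] Suc.prems
      by (meson Diff_subset finite_Diff order_trans)
  qed
qed

text \<open>The degree sum counts every edge across once from each side; the nonadjacent pairs
  complete the product.\<close>

lemma degree_sum_bipartite:
  assumes "finite S" "X \<subseteq> S" "\<forall>u\<in>X. \<forall>v\<in>X. \<not> E u v" "\<forall>u\<in>S - X. \<forall>v\<in>S - X. \<not> E u v"
  shows "degree_sum E S + 2 * (\<Sum>x\<in>X. card {y \<in> S - X. \<not> E x y}) = 2 * (card X * card (S - X))"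
proof -
  have finX: "finite X" using assms finite_subset by blast
  have "degree_sum E S = (\<Sum>u\<in>X. card (nbrs E u S)) + (\<Sum>u\<in>S - X. card (nbrs E u S))"
    unfolding degree_sum_def using assms by (metis add.commute sum.subset_diff)
  also have "(\<Sum>u\<in>X. card (nbrs E u S)) = (\<Sum>u\<in>X. card {v \<in> S - X. E u v})"
    using assms by (intro sum.cong arg_cong[where f = card]) (auto simp: nbrs_def)
  also have "(\<Sum>u\<in>S - X. card (nbrs E u S)) = (\<Sum>u\<in>S - X. card {v \<in> X. E v u})"
    using assms sym by (intro sum.cong arg_cong[where f = card]) (auto simp: nbrs_def)
  also have "\<dots> = (\<Sum>u\<in>X. card {v \<in> S - X. E u v})"
    using assms finX by (intro sum_multicount_gen[symmetric]) auto
  finally have "degree_sum E S = 2 * (\<Sum>u\<in>X. card {v \<in> S - X. E u v})" by simp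
  moreover have "(\<Sum>u\<in>X. card {v \<in> S - X. E u v}) + (\<Sum>u\<in>X. card {v \<in> S - X. \<not> E u v}) =
      (\<Sum>u\<in>X. card (S - X))"
    unfolding sum.distrib[symmetric]
  proof (rule sum.cong)
    fix u assume "u \<in> X"
    have "card (S - X) = card ({v \<in> S - X. E u v} \<union> {v \<in> S - X. \<not> E u v})"
      by (rule arg_cong[where f = card]) auto
    also have "\<dots> = card {v \<in> S - X. E u v} + card {v \<in> S - X. \<not> E u v}"
      using assms(1) by (intro card_Un_disjoint) auto
    finally show "card {v \<in> S - X. E u v} + card {v \<in> S - X. \<not> E u v} = card (S - X)" by simp
  qed simp
  ultimately show ?thesis by simp
qed

text \<open>A side contains the neighbourhood of a vertex of the other, so each has between
  \<open>9 / 20\<close> and \<open>11 / 20\<close> of \<open>S\<close>, while twice a degree is at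
  least \<open>18 / 20\<close> of it.\<close>

lemma linked_of_bipartite_min_degree:
  assumes fin: "finite S" and X: "X \<subseteq> S" "\<forall>u\<in>X. \<forall>v\<in>X. \<not> E u v" "\<forall>u\<in>S - X. \<forall>v\<in>S - X. \<not> E u v"
    and mindeg: "\<And>u. u \<in> S \<Longrightarrow> 9 * card S \<le> 20 * card (nbrs E u S)"
    and large: "10000 * k \<le> card S"
  shows "linked E S X (4 * k + 1)"
proof -
  let ?Y = "S - X"
  have finX: "finite X" using X fin finite_subset by blast
  have split: "card X + card ?Y = card S"
    using X fin finX by (simp add: card_Diff_subset card_mono)
  have dX: "nbrs E u S = nbrs E u ?Y" if "u \<in> X" for u using that X by (auto simp: nbrs_def)
  have dY: "nbrs E u S = nbrs E u X" if "u \<in> ?Y" for u using that X by (auto simp: nbrs_def)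
  have pos: "card S > 0" using large k by linarith
  have nY: "9 * card S \<le> 20 * card ?Y" if "u \<in> X" for u
    using mindeg[of u] that X dX card_mono[OF _ nbrs_subset[of E u ?Y]] fin by fastforce
  have nX: "9 * card S \<le> 20 * card X" if "u \<in> ?Y" for u
    using mindeg[of u] that dY card_mono[OF finX nbrs_subset[of E u X]] by fastforce
  have ne: "X \<noteq> {}" "?Y \<noteq> {}"
  proof -
    obtain u where "u \<in> S" using pos by fastforce
    then show "X \<noteq> {}" "?Y \<noteq> {}" using nX nY pos by fastforce+
  qed
  have "linked E (X \<union> ?Y) X (4 * k + 1)"
  proof (rule linkedI)
    fix u assume u: "u \<in> X"
    show "card ?Y + (4 * k + 1) < 2 * card (nbrs E u ?Y)"
      using mindeg[of u] u X dX[OF u] nX ne split large k by force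
  next
    fix u assume u: "u \<in> ?Y"
    show "card X + (4 * k + 1) < 2 * card (nbrs E u X)"
      using mindeg[of u] u X dY[OF u] nY ne split large k by force
  qed (use fin finX in auto)
  moreover have "X \<union> ?Y = S" using X by auto
  ultimately show ?thesis by simp
qed

text \<open>Compare the potential at \<open>V\<close> and at \<open>S\<close>. Bipartiteness bounds
  the degree sum of \<open>S\<close> by \<open>s^2 / 2\<close> less twice the number
  \<open>M\<close> of missing pairs, so \<open>(n - s) * n / 20 + 2 * M \<le> 2 * t\<close>, which
  gives both bounds.\<close>

lemma exists_bipartite_core:
  assumes fin: "finite V" and large: "100000 * k \<le> card V" and t: "0 \<le> t" "t \<le> (real (card V))\<^sup>2 / 160"
    and dense: "(real (card V))\<^sup>2 / 2 - 2 * t \<le> real (degree_sum E V)"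
  shows "\<exists>S X. S \<subseteq> V \<and> X \<subseteq> S \<and> linked E S X (4 * k + 1) \<and>
    (\<forall>u\<in>X. \<forall>v\<in>X. \<not> E u v) \<and> (\<forall>u\<in>S - X. \<forall>v\<in>S - X. \<not> E u v) \<and>
    real (card (V - S)) * real (card V) \<le> 40 * t \<and>
    real (\<Sum>x\<in>X. card {y \<in> S - X. \<not> E x y}) \<le> t"
proof -
  obtain S where S: "S \<subseteq> V" and mindeg: "\<And>u. u \<in> S \<Longrightarrow> 9 * card S \<le> 20 * card (nbrs E u S)"
    and pot: "real (degree_sum E V) - 9 / 20 * (real (card V))\<^sup>2 - real (card V) / 2 \<le>
      real (degree_sum E S) - 9 / 20 * (real (card S))\<^sup>2 - real (card S) / 2"
    using exists_min_degree_subset[OF fin] by blast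
  have finS: "finite S" using S fin finite_subset by blast
  define n s where "n = real (card V)" and "s = real (card S)"
  have n: "n \<ge> 200000" using large k unfolding n_def by linarith
  have s: "0 \<le> s" "s \<le> n" using card_mono[OF fin S] by (auto simp: n_def s_def)
  \<comment> \<open>This crude bound only yields \<open>s \<ge> n / 5\<close>, so that
    \<open>S\<close> is large enough for the bipartition.\<close>
  have "real (degree_sum E S) \<le> s\<^sup>2"
    using degree_sum_le[OF finS, of E] unfolding s_def power2_eq_square by (metis of_nat_le_iff of_nat_mult)
  then have "n\<^sup>2 / 20 - 2 * t - n / 2 \<le> 11 / 20 * s\<^sup>2 - s / 2"
    using pot dense unfolding n_def[symmetric] s_def[symmetric] by (simp add: field_simps)
  moreover have "n / 2 \<le> n\<^sup>2 / 400" using n by (simp add: power2_eq_square field_simps)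
  ultimately have "(n / 5)\<^sup>2 \<le> s\<^sup>2"
    using t s unfolding n_def[symmetric] by (simp add: power_divide)
  then have sn: "n / 5 \<le> s" using s(1) by (rule power2_le_imp_le)
  then have largeS: "10000 * k \<le> card S" using large unfolding n_def s_def by linarith
  obtain X where X: "X \<subseteq> S" "\<forall>u\<in>X. \<forall>v\<in>X. \<not> E u v" "\<forall>u\<in>S - X. \<forall>v\<in>S - X. \<not> E u v"
    using bipartite_of_min_degree[OF finS mindeg largeS] by blast
  define M where "M = real (\<Sum>x\<in>X. card {y \<in> S - X. \<not> E x y})"
  have M0: "0 \<le> M" unfolding M_def by (rule of_nat_0_le_iff)
  have bip: "real (degree_sum E S) + 2 * M = 2 * (real (card X) * real (card (S - X)))"
    using arg_cong[OF degree_sum_bipartite[OF finS X], of real] by (simp add: M_def)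
  have "s = real (card X) + real (card (S - X))"
    using X(1) finS finite_subset[OF X(1) finS] by (simp add: s_def card_Diff_subset card_mono)
  then have "2 * (real (card X) * real (card (S - X))) \<le> s\<^sup>2 / 2"
    using sum_squares_bound[of "real (card X)" "real (card (S - X))"] by (simp add: power2_sum)
  with bip pot dense have "(n\<^sup>2 - s\<^sup>2) / 20 - (n - s) / 2 + 2 * M \<le> 2 * t"
    unfolding n_def[symmetric] s_def[symmetric] by (simp add: field_simps)
  moreover have "(n\<^sup>2 - s\<^sup>2) / 20 - (n - s) / 2 = (n - s) * ((n + s) / 20 - 1 / 2)"
    by (simp add: power2_eq_square field_simps)
  \<comment> \<open>The term \<open>1 / 2\<close> is absorbed by \<open>s / 20\<close>, as
    \<open>s \<ge> n / 5 \<ge> 10\<close>.\<close>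
  moreover have "(n - s) * (n / 20) \<le> (n - s) * ((n + s) / 20 - 1 / 2)"
    using s sn n by (intro mult_left_mono) (simp_all add: field_simps)
  ultimately have fin_bd: "(n - s) * (n / 20) + 2 * M \<le> 2 * t" by linarith
  then have "(n - s) * n \<le> 40 * t" using M0 by simp
  moreover have "real (card (V - S)) = n - s"
    using S fin finS by (simp add: n_def s_def card_Diff_subset card_mono of_nat_diff)
  moreover have "M \<le> t" using fin_bd mult_nonneg_nonneg[of "n - s" "n / 20"] s n by linarith
  ultimately show ?thesis
    using S X linked_of_bipartite_min_degree[OF finS X mindeg largeS] unfolding n_def M_def
    by (intro exI[of _ S] exI[of _ X]) auto
qed

section \<open>Paths joining a missing pair\<close>

lemma alternating_path:
  assumes "successively E zs" "zs \<noteq> []" "set zs \<subseteq> S"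
    "\<forall>u\<in>X. \<forall>v\<in>X. \<not> E u v" "\<forall>u\<in>S - X. \<forall>v\<in>S - X. \<not> E u v"
  shows "(hd zs \<in> X \<longleftrightarrow> last zs \<in> X) \<longleftrightarrow> odd (length zs)"
  using assms
proof (induction zs)
  case (Cons z zs)
  show ?case
  proof (cases "zs = []")
    case False
    then have "E z (hd zs)" "hd zs \<in> S" using Cons.prems by (auto simp: successively_Cons)
    then have "z \<in> X \<longleftrightarrow> hd zs \<notin> X" using Cons.prems by auto
    moreover have "(hd zs \<in> X \<longleftrightarrow> last zs \<in> X) \<longleftrightarrow> odd (length zs)"
      using Cons False by (auto simp: successively_Cons)
    ultimately show ?thesis using False by auto
  qed simp
qed simp

text \<open>The path has an even number of edges but joins opposite sides, so it leaves
  \<open>S\<close>. Cut it into \<open>pre\<close> before the first exit, \<open>suf\<close> after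
  the last return and \<open>ms\<close> between them; \<open>ms\<close> closes up unless
  \<open>pre\<close> and \<open>suf\<close> are single vertices.\<close>

lemma path_between_sides:
  assumes lk: "linked E S X (4 * k + 1)"
    and ind: "\<forall>u\<in>X. \<forall>v\<in>X. \<not> E u v" "\<forall>u\<in>S - X. \<forall>v\<in>S - X. \<not> E u v"
    and xy: "x \<in> X" "x \<in> S" "y \<in> S - X"
    and xs: "distinct xs" "length xs = 2 * k + 1" "successively E xs" "hd xs = x" "last xs = y"
  shows "\<exists>ms. xs = x # ms @ [y] \<and> ms \<noteq> [] \<and> last ms \<notin> S"
proof -
  have ne: "xs \<noteq> []" using xs by auto
  have "\<not> set xs \<subseteq> S"
    using alternating_path[OF xs(3) ne _ ind] xs xy by auto
  then have "\<exists>z\<in>set xs. z \<notin> S" by auto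
  then obtain pre r post where 1: "xs = pre @ r # post" "r \<notin> S" "\<forall>z\<in>set pre. z \<in> S"
    using split_list_first_prop[of xs "\<lambda>z. z \<notin> S"] by auto
  \<comment> \<open>The search starts at \<open>r\<close> itself, so \<open>r'\<close> may be
    \<open>r\<close>, with \<open>mid\<close> empty.\<close>
  have "\<exists>z\<in>set (r # post). z \<notin> S" using 1 by auto
  then obtain mid r' suf where 2: "r # post = mid @ r' # suf" "r' \<notin> S" "\<forall>z\<in>set suf. z \<in> S"
    using split_list_last_prop[of "r # post" "\<lambda>z. z \<notin> S"] by auto
  define ms where "ms = mid @ [r']"
  have split: "xs = pre @ ms @ suf" using 1 2 by (simp add: ms_def)
  have pre: "pre \<noteq> []" using 1 xs xy by (cases pre) auto
  have suf: "suf \<noteq> []"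
  proof
    assume "suf = []"
    then have "last xs = r'" using split by (simp add: ms_def)
    then show False using 2 xs xy by auto
  qed
  have ms: "ms \<noteq> []" "last ms = r'" by (auto simp: ms_def)
  have ends: "hd pre = x" "last suf = y" using split pre suf xs by auto
  have suc: "successively E pre" "successively E ms" "successively E suf"
    "E (last pre) (hd ms)" "E (last ms) (hd suf)"
    using xs(3) pre suf ms unfolding split by (auto simp: successively_append_iff)
  have len: "length pre + length ms + length suf = 2 * k + 1" using xs split by simp
  have "(last pre \<in> X) \<longleftrightarrow> odd (length pre)"
    using alternating_path[OF suc(1) pre _ ind] 1(3) ends xy by auto
  moreover have "(hd suf \<in> X) \<longleftrightarrow> even (length suf)"
    using alternating_path[OF suc(3) suf _ ind] 2(3) ends xy by auto
  moreover have "even (length ms) \<longleftrightarrow> odd (length pre + length suf)"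
    using len by presburger
  ultimately have par: "(last pre \<in> X \<longleftrightarrow> hd suf \<in> X) \<longleftrightarrow> even (length ms)" by auto
  have dist: "last pre \<in> set pre" "hd suf \<in> set suf" using pre suf by auto
  have "set pre \<inter> set ms = {}" "set ms \<inter> set suf = {}" "set pre \<inter> set suf = {}" "distinct ms"
    using xs(1) unfolding split by auto
  then have "last pre \<noteq> hd suf" "last pre \<notin> set ms" "hd suf \<notin> set ms" "distinct ms"
    using dist by auto
  \<comment> \<open>If \<open>pre\<close> or \<open>suf\<close> had two vertices,
    \<open>length ms + 2 \<le> 2 * k\<close> would hold.\<close>
  then have "\<not> length ms + 2 \<le> 2 * k"
    using no_odd_closure[OF lk, of ms "last pre" "hd suf"] suc ms par dist 1(3) 2(3) by blast
  moreover have "length pre > 0" "length suf > 0" using pre suf by auto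
  ultimately have "length pre = 1" "length suf = 1" using len by linarith+
  then have "pre = [x]" "suf = [y]" using ends by (auto simp: length_Suc_conv)
  then show ?thesis using split ms 2 by auto
qed

section \<open>Discarding the exceptional vertices\<close>

lemma large_complete_bipartite:
  assumes fin: "finite V" and EV: "\<And>u v. E u v \<Longrightarrow> u \<in> V"
    and saturated: "\<And>u v. \<lbrakk>u \<in> V; v \<in> V; u \<noteq> v; \<not> E u v\<rbrakk> \<Longrightarrow>
      \<exists>xs. distinct xs \<and> length xs = 2 * k + 1 \<and> successively E xs \<and> hd xs = u \<and> last xs = v"
    and large: "100000 * k \<le> card V" and t: "0 \<le> t" "t \<le> (real (card V))\<^sup>2 / 160"
    and dense: "(real (card V))\<^sup>2 / 2 - 2 * t \<le> real (degree_sum E V)"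
  shows "\<exists>A B. A \<inter> B = {} \<and> A \<union> B \<subseteq> V \<and> (\<forall>u\<in>A. \<forall>v\<in>A. \<not> E u v) \<and> (\<forall>u\<in>B. \<forall>v\<in>B. \<not> E u v) \<and>
    (\<forall>u\<in>A. \<forall>v\<in>B. E u v) \<and>
    real (card V) - (80 * real k + 121) * (t / sqrt (real (card V))) \<le> real (card (A \<union> B))"
proof -
  define n where "n = real (card V)"
  obtain S X where S: "S \<subseteq> V" and X: "X \<subseteq> S" and lk: "linked E S X (4 * k + 1)"
    and ind: "\<forall>u\<in>X. \<forall>v\<in>X. \<not> E u v" "\<forall>u\<in>S - X. \<forall>v\<in>S - X. \<not> E u v"
    and rest: "real (card (V - S)) * n \<le> 40 * t"
    and missing: "real (\<Sum>x\<in>X. card {y \<in> S - X. \<not> E x y}) \<le> t"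
    using exists_bipartite_core[OF fin large t dense] unfolding n_def by blast
  have finS: "finite S" "finite X" "finite (S - X)"
    using finite_subset[OF S fin] finite_subset[OF X] by auto
  have n: "n \<ge> 1" using large k unfolding n_def by linarith
  \<comment> \<open>The threshold \<open>sqrt n\<close> balances the losses: \<open>D\<close> costs
    \<open>t / q\<close>, and \<open>C\<close> about \<open>q\<close> for each of the at most
    \<open>40 * t / n\<close> vertices outside \<open>S\<close>.\<close>
  define q where "q = sqrt n"
  have q: "q \<ge> 1" "q * q = n" using n by (auto simp: q_def)
  define D where "D = {x \<in> X. q < real (card {y \<in> S - X. \<not> E x y})}"
  \<comment> \<open>The slack \<open>2 * k + 1\<close> accounts for neighbours of \<open>r\<close>
    lying on the path itself.\<close>
  define R where "R = {r \<in> V - S. real (card (nbrs E r (S - X))) \<le> q + 2 * real k + 1}"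
  define C where "C = (\<Union>r\<in>R. nbrs E r (S - X))"
  define A where "A = X - D"
  define B where "B = S - X - C"
  have finR: "finite R" "finite C" using fin finS by (auto simp: R_def C_def)
  have complete: "E x y" if "x \<in> A" "y \<in> B" for x y
  proof (rule ccontr)
    assume nE: "\<not> E x y"
    have xy: "x \<in> X" "x \<in> S" "y \<in> S - X" "x \<noteq> y" using that X by (auto simp: A_def B_def)
    obtain xs where xs: "distinct xs" "length xs = 2 * k + 1" "successively E xs" "hd xs = x" "last xs = y"
      using saturated[of x y] nE xy S by blast
    obtain ms where ms: "xs = x # ms @ [y]" "ms \<noteq> []" "last ms \<notin> S"
      using path_between_sides[OF lk ind xy(1-3) xs] by blast
    let ?r = "last ms"
    have Ery: "E ?r y" using xs(3) ms by (auto simp: successively_Cons successively_append_iff)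
    \<comment> \<open>A neighbour \<open>z\<close> of \<open>?r\<close> off the path and adjacent to
      \<open>x\<close> could replace \<open>y\<close>, and \<open>x # ms @ [z]\<close> would close
      to a forbidden cycle.\<close>
    have "nbrs E ?r (S - X) \<subseteq> {y \<in> S - X. \<not> E x y} \<union> set xs"
    proof
      fix z assume z: "z \<in> nbrs E ?r (S - X)"
      show "z \<in> {y \<in> S - X. \<not> E x y} \<union> set xs"
      proof (rule ccontr)
        assume "\<not> ?thesis"
        then have "E x z" "z \<notin> set xs" using z by (auto simp: nbrs_def)
        then show False
          using no_cycle[of "x # ms @ [z]"] xs ms z sym
          by (auto simp: nbrs_def successively_Cons successively_append_iff)
      qed
    qed
    then have "card (nbrs E ?r (S - X)) \<le> card ({y \<in> S - X. \<not> E x y} \<union> set xs)"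
      using finS by (intro card_mono) auto
    also have "\<dots> \<le> card {y \<in> S - X. \<not> E x y} + (2 * k + 1)"
      using card_Un_le[of "{y \<in> S - X. \<not> E x y}" "set xs"] xs(1,2) by (simp add: distinct_card)
    finally have "real (card (nbrs E ?r (S - X))) \<le> real (card {y \<in> S - X. \<not> E x y}) + 2 * real k + 1"
      by linarith
    also have "\<dots> \<le> q + 2 * real k + 1" using that by (auto simp: A_def D_def)
    finally have "?r \<in> R" using ms EV[OF Ery] by (auto simp: R_def)
    then have "y \<in> C" using Ery xy by (auto simp: C_def nbrs_def)
    then show False using that by (auto simp: B_def)
  qed
  have "real (card D) * q \<le> real (\<Sum>x\<in>X. card {y \<in> S - X. \<not> E x y})"
    using finS q by (intro card_le_by_markov) (auto simp: D_def)
  then have cD: "real (card D) * q \<le> t" using missing by linarith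
  have "card C \<le> (\<Sum>r\<in>R. card (nbrs E r (S - X)))"
    unfolding C_def using finR by (intro card_UN_le)
  then have "real (card C) \<le> (\<Sum>r\<in>R. real (card (nbrs E r (S - X))))"
    by (metis of_nat_le_iff of_nat_sum)
  also have "\<dots> \<le> real (card R) * (q + 2 * real k + 1)"
    by (rule sum_bounded_above) (auto simp: R_def)
  also have "\<dots> \<le> real (card (V - S)) * (q + 2 * real k + 1)"
    using fin q by (intro mult_right_mono) (auto simp: R_def intro!: card_mono)
  finally have cC: "real (card C) \<le> real (card (V - S)) * (q + 2 * real k + 1)" .
  have "V \<subseteq> (A \<union> B) \<union> ((V - S) \<union> (D \<union> C))" by (auto simp: A_def B_def)
  then have "card V \<le> card ((A \<union> B) \<union> ((V - S) \<union> (D \<union> C)))"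
    using fin finS finR by (intro card_mono) (auto simp: A_def B_def D_def)
  also have "\<dots> \<le> card (A \<union> B) + (card (V - S) + (card D + card C))"
    by (meson add_left_mono card_Un_le order_trans)
  finally have "n \<le> real (card (A \<union> B)) + real (card (V - S)) + real (card D) + real (card C)"
    unfolding n_def by linarith
  also have "\<dots> \<le> real (card (A \<union> B)) + real (card D) + real (card (V - S)) * (q + 2 * real k + 2)"
    using cC by (simp add: algebra_simps)
  finally have n1: "n \<le> real (card (A \<union> B)) + real (card D) + real (card (V - S)) * (q + 2 * real k + 2)" .
  have "real (card D) \<le> t / q" using cD q by (simp add: field_simps)
  moreover have "real (card (V - S)) * (q + 2 * real k + 2) \<le> 40 * (2 * real k + 3) * (t / q)"
  proof -
    have "real (card (V - S)) * (q + 2 * real k + 2) \<le> real (card (V - S)) * ((2 * real k + 3) * q)"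
    proof (rule mult_left_mono)
      have "(2 * real k + 2) * 1 \<le> (2 * real k + 2) * q" using q by (intro mult_left_mono) auto
      then show "q + 2 * real k + 2 \<le> (2 * real k + 3) * q" by (simp add: algebra_simps)
    qed simp
    also have "\<dots> = (2 * real k + 3) * (real (card (V - S)) * n / q)"
      using q by (simp add: field_simps flip: q(2))
    also have "\<dots> \<le> (2 * real k + 3) * (40 * t / q)"
      using rest q by (intro mult_left_mono divide_right_mono) auto
    finally show ?thesis by (simp add: algebra_simps add_divide_distrib)
  qed
  \<comment> \<open>One \<open>t / q\<close> pays for \<open>D\<close>, the other
    \<open>40 * (2 * k + 3)\<close> for \<open>V - S\<close> and \<open>C\<close>.\<close>
  moreover have coeff: "(80 * real k + 121) * c = c + 40 * (2 * real k + 3) * c" for c :: real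
    by (simp add: algebra_simps)
  ultimately have "n - (80 * real k + 121) * (t / q) \<le> real (card (A \<union> B))"
    using n1 coeff[of "t / q"] by linarith
  moreover have "A \<inter> B = {}" "A \<union> B \<subseteq> V" using S X by (auto simp: A_def B_def)
  ultimately show ?thesis
    using ind complete unfolding n_def q_def
    by (intro exI[of _ A] exI[of _ B]) (auto simp: A_def B_def)
qed

end

section \<open>From the graph encoding to the adjacency relation\<close>

abbreviation adj :: "'a ugraph \<Rightarrow> 'a \<Rightarrow> 'a \<Rightarrow> bool" where
  "adj G u v \<equiv> {u, v} \<in> edges G"

lemma adj_verts:
  assumes "simple_graph G" "adj G u v"
  shows "u \<in> verts G \<and> v \<in> verts G \<and> u \<noteq> v"
proof -
  have "{u, v} \<subseteq> verts G" "card {u, v} = 2" using assms unfolding simple_graph_def by blast+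
  then show ?thesis by (cases "u = v") auto
qed

text \<open>Indexing into \<open>xs\<close> is the isomorphism from \<open>cycle_graph m\<close>;
  the wrap-around index gives the closing edge.\<close>

lemma not_graph_free_cycleI:
  assumes G: "simple_graph G" and xs: "distinct xs" "length xs = m" "xs \<noteq> []"
    "successively (adj G) xs" "adj G (last xs) (hd xs)"
  shows "\<not> graph_free (cycle_graph m) G"
proof -
  have adj: "adj G (xs ! i) (xs ! ((i + 1) mod m))" if "i < m" for i
  proof (cases "Suc i < m")
    case True
    then show ?thesis using successively_nth[OF xs(4), of i] xs by simp
  next
    case False
    then have "Suc i = m" using that by simp
    then have "i = length xs - 1" "(i + 1) mod m = 0" using xs by auto
    then show ?thesis using xs by (simp add: last_conv_nth hd_conv_nth)
  qed
  have edges: "(\<lambda>e. (!) xs ` e) ` edges (cycle_graph m) = {{xs ! i, xs ! ((i + 1) mod m)} | i. i < m}"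
    by (auto simp: cycle_graph_def image_iff) blast+
  let ?H = "(set xs, (\<lambda>e. (!) xs ` e) ` edges (cycle_graph m))"
  have sub: "edges ?H \<subseteq> edges G" unfolding snd_conv edges using adj by auto
  have "bij_betw ((!) xs) {..<m} (set xs)"
    using xs by (intro bij_betw_nth) auto
  then have "graph_iso (cycle_graph m) ?H"
    unfolding graph_iso_def by (auto simp: cycle_graph_def)
  moreover have "subgraph_of ?H G"
    unfolding subgraph_of_def
  proof (intro conjI sub)
    show "verts ?H \<subseteq> verts G"
    proof
      fix v assume "v \<in> verts ?H"
      then obtain i where "i < m" "v = xs ! i" using xs by (auto simp: in_set_conv_nth)
      then show "v \<in> verts G" using adj adj_verts[OF G] by blast
    qed
    have "0 < m" using xs by auto
    then have "\<forall>e\<in>edges ?H. e \<subseteq> set xs" unfolding snd_conv edges using xs(2) by auto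
    moreover have "\<forall>e\<in>edges ?H. card e = 2" using sub G by (auto simp: simple_graph_def)
    ultimately show "simple_graph ?H" unfolding simple_graph_def by simp
  qed
  ultimately show ?thesis unfolding graph_free_def by blast
qed

text \<open>The cycle created by adding \<open>u v\<close> must use that edge; without it, the cycle
  is a path through its \<open>m\<close> vertices from \<open>u\<close> to \<open>v\<close>.\<close>

lemma path_of_maximal_free:
  assumes max: "maximal_free (cycle_graph m) G" and m: "m \<ge> 3"
    and uv: "u \<in> verts G" "v \<in> verts G" "u \<noteq> v" "\<not> adj G u v"
  shows "\<exists>xs. distinct xs \<and> length xs = m \<and> successively (adj G) xs \<and> hd xs = u \<and> last xs = v"
proof -
  have "\<not> graph_free (cycle_graph m) (add_edge u v G)" using max uv by (auto simp: maximal_free_def)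
  then obtain H where H: "subgraph_of H (add_edge u v G)" "graph_iso (cycle_graph m) H"
    by (auto simp: graph_free_def)
  then obtain \<phi> where \<phi>: "bij_betw \<phi> (verts (cycle_graph m)) (verts H)"
    "edges H = (\<lambda>e. \<phi> ` e) ` edges (cycle_graph m)" by (auto simp: graph_iso_def)
  have inj: "inj_on \<phi> {..<m}" using \<phi>(1) by (simp add: cycle_graph_def bij_betw_def)
  have edge: "{\<phi> i, \<phi> ((i + 1) mod m)} \<in> edges H" if "i < m" for i
  proof -
    have "{i, (i + 1) mod m} \<in> edges (cycle_graph m)" using that by (auto simp: cycle_graph_def)
    then have "\<phi> ` {i, (i + 1) mod m} \<in> edges H" unfolding \<phi>(2) by (rule imageI)
    then show ?thesis by simp
  qed
  have sub: "edges H \<subseteq> insert {u, v} (edges G)" using H by (simp add: subgraph_of_def add_edge_def)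
  have "{u, v} \<in> edges H"
  proof (rule ccontr)
    assume "{u, v} \<notin> edges H"
    then have "subgraph_of H G" using H by (auto simp: subgraph_of_def add_edge_def)
    then show False using max H unfolding maximal_free_def graph_free_def by blast
  qed
  then obtain i0 where i0: "i0 < m" "{u, v} = {\<phi> i0, \<phi> ((i0 + 1) mod m)}"
    unfolding \<phi>(2) by (auto simp: cycle_graph_def)
  \<comment> \<open>Reading starts just after position \<open>i0\<close>, so the added edge is the
    one between the last and the first entry.\<close>
  define xs where "xs = map (\<lambda>j. \<phi> ((i0 + 1 + j) mod m)) [0..<m]"
  have shift: "j = j'" if "j < m" "j' < m" "(i0 + 1 + j) mod m = (i0 + 1 + j') mod m" for j j'
    using that
  proof (induction j j' rule: linorder_wlog)
    case (le j j')
    have "m dvd (i0 + 1 + j') - (i0 + 1 + j)"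
      using le by (subst mod_eq_dvd_iff_nat[symmetric]) auto
    then have "m dvd j' - j" by simp
    then show ?case using le dvd_imp_le[of m "j' - j"] by (cases "j' = j") auto
  next
    case (sym j j')
    then show ?case by simp
  qed
  have len: "length xs = m" by (simp add: xs_def)
  have "inj_on (\<lambda>j. \<phi> ((i0 + 1 + j) mod m)) {0..<m}"
  proof (rule inj_onI)
    fix j j' assume j: "j \<in> {0..<m}" "j' \<in> {0..<m}"
      "\<phi> ((i0 + 1 + j) mod m) = \<phi> ((i0 + 1 + j') mod m)"
    have "(i0 + 1 + j) mod m = (i0 + 1 + j') mod m" using j m by (intro inj_onD[OF inj]) auto
    moreover have "j < m" "j' < m" using j by auto
    ultimately show "j = j'" by (rule shift[rotated 2])
  qed
  then have dist: "distinct xs" by (simp add: xs_def distinct_map)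
  have "successively (adj G) xs"
    unfolding successively_conv_nth
  proof (intro allI impI)
    fix j assume "Suc j < length xs"
    then have j: "Suc j < m" by (simp add: len)
    let ?a = "(i0 + 1 + j) mod m"
    have next_idx: "(?a + 1) mod m = (i0 + 1 + Suc j) mod m" by (simp add: mod_simps)
    have "{xs ! j, xs ! Suc j} = {\<phi> ?a, \<phi> ((?a + 1) mod m)}"
      unfolding next_idx using j by (simp add: xs_def)
    then have "{xs ! j, xs ! Suc j} \<in> insert {u, v} (edges G)" using edge[of ?a] sub m by auto
    \<comment> \<open>Neighbouring entries could be the first and the last only for
      \<open>m = 2\<close>.\<close>
    moreover have "{xs ! j, xs ! Suc j} \<noteq> {u, v}"
    proof
      assume eq: "{xs ! j, xs ! Suc j} = {u, v}"
      have "\<phi> i0 = xs ! (m - 1)" "\<phi> ((i0 + 1) mod m) = xs ! 0"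
        using i0(1) m by (auto simp: xs_def)
      then have "{xs ! j, xs ! Suc j} = {xs ! (m - 1), xs ! 0}" using eq i0(2) by simp
      then show False
        using dist j m len by (auto simp: doubleton_eq_iff nth_eq_iff_index_eq)
    qed
    ultimately show "adj G (xs ! j) (xs ! Suc j)" by simp
  qed
  moreover have "hd xs = \<phi> ((i0 + 1) mod m)" "last xs = \<phi> i0"
    using i0(1) m by (auto simp: xs_def hd_map last_map)
  ultimately consider "hd xs = u" "last xs = v" "successively (adj G) xs"
    | "hd xs = v" "last xs = u" "successively (adj G) xs"
    using i0(2) by (auto simp: doubleton_eq_iff)
  then show ?thesis
  proof cases
    case 1
    then show ?thesis using dist len by blast
  next
    case 2
    moreover have "xs \<noteq> []" using len m by auto
    ultimately show ?thesis using dist len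
      by (intro exI[of _ "rev xs"]) (auto simp: hd_rev last_rev insert_commute)
  qed
qed

text \<open>Handshaking, in the direction that carries the edge bound over to
  \<open>degree_sum\<close>.\<close>

lemma double_card_edges_le:
  assumes "simple_graph G"
  shows "2 * card (edges G) \<le> degree_sum (adj G) (verts G)"
proof -
  have fin: "finite (verts G)" using assms by (simp add: simple_graph_def)
  have "edges G \<subseteq> Pow (verts G)" using assms by (auto simp: simple_graph_def)
  then have finE: "finite (edges G)" using fin by (meson finite_Pow_iff finite_subset)
  have "(\<Sum>e\<in>edges G. 2) = (\<Sum>u\<in>verts G. card {e \<in> edges G. u \<in> e})"
  proof (rule sum_multicount_gen[symmetric, OF fin finE], rule ballI)
    fix e assume "e \<in> edges G"
    then have "{u \<in> verts G. u \<in> e} = e" "card e = 2" using assms by (auto simp: simple_graph_def)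
    then show "card {u \<in> verts G. u \<in> e} = 2" by simp
  qed
  also have "\<dots> \<le> degree_sum (adj G) (verts G)"
    unfolding degree_sum_def
  proof (rule sum_mono)
    fix u
    have "{e \<in> edges G. u \<in> e} \<subseteq> (\<lambda>v. {u, v}) ` nbrs (adj G) u (verts G)"
    proof
      fix e assume "e \<in> {e \<in> edges G. u \<in> e}"
      then have e: "e \<in> edges G" "u \<in> e" "e \<subseteq> verts G" "card e = 2" using assms by (auto simp: simple_graph_def)
      then obtain v where "e = {u, v}" by (auto simp: card_2_iff)
      then show "e \<in> (\<lambda>v. {u, v}) ` nbrs (adj G) u (verts G)" using e by (auto simp: nbrs_def)
    qed
    then show "card {e \<in> edges G. u \<in> e} \<le> card (nbrs (adj G) u (verts G))"
      using fin by (meson surj_card_le finite_nbrs)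
  qed
  finally show ?thesis by simp
qed

text \<open>The explicit form of the result for a single graph, with error
  \<open>O(k * t / sqrt n)\<close>; only the asymptotics remain.\<close>

lemma maximal_free_induced_complete_bipartite:
  assumes k: "k \<ge> 2" and G: "simple_graph G" and max: "maximal_free (cycle_graph (2 * k + 1)) G"
    and large: "100000 * k \<le> card (verts G)" and t: "0 \<le> t" "t \<le> (real (card (verts G)))\<^sup>2 / 160"
    and dense: "(real (card (verts G)))\<^sup>2 / 4 - t \<le> real (card (edges G))"
  shows "\<exists>W\<subseteq>verts G. complete_bipartite (induced_subgraph G W) \<and>
    real (card (verts G)) - (80 * real k + 121) * (t / sqrt (real (card (verts G)))) \<le> real (card W)"
proof -
  interpret odd_cycle_free "adj G" k
  proof
    show "adj G v u" if "adj G u v" for u v using that by (simp add: insert_commute)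
    show "\<not> adj G u u" for u using adj_verts[OF G] by blast
    show "k \<ge> 2" by (rule k)
    show False if "distinct xs" "length xs = 2 * k + 1" "successively (adj G) xs" "adj G (last xs) (hd xs)" for xs
    proof -
      have "xs \<noteq> []" using that(2) by auto
      then show False
        using not_graph_free_cycleI[OF G that(1,2) _ that(3,4)] max unfolding maximal_free_def by blast
    qed
  qed
  have "real (2 * card (edges G)) \<le> real (degree_sum (adj G) (verts G))"
    using double_card_edges_le[OF G] by (rule of_nat_mono)
  then have dense2: "(real (card (verts G)))\<^sup>2 / 2 - 2 * t \<le> real (degree_sum (adj G) (verts G))"
    using dense by simp
  have fin: "finite (verts G)" using G by (simp add: simple_graph_def)
  have sat: "\<exists>xs. distinct xs \<and> length xs = 2 * k + 1 \<and> successively (adj G) xs \<and> hd xs = u \<and> last xs = v"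
    if "u \<in> verts G" "v \<in> verts G" "u \<noteq> v" "\<not> adj G u v" for u v
    using k by (intro path_of_maximal_free[OF max _ that]) auto
  have "\<exists>A B. A \<inter> B = {} \<and> A \<union> B \<subseteq> verts G \<and> (\<forall>u\<in>A. \<forall>v\<in>A. \<not> adj G u v) \<and>
    (\<forall>u\<in>B. \<forall>v\<in>B. \<not> adj G u v) \<and> (\<forall>u\<in>A. \<forall>v\<in>B. adj G u v) \<and>
    real (card (verts G)) - (80 * real k + 121) * (t / sqrt (real (card (verts G)))) \<le> real (card (A \<union> B))"
    using adj_verts[OF G] by (intro large_complete_bipartite fin sat large t dense2) blast+
  then obtain A B where AB: "A \<inter> B = {}" "A \<union> B \<subseteq> verts G" "\<forall>u\<in>A. \<forall>v\<in>A. \<not> adj G u v"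
    "\<forall>u\<in>B. \<forall>v\<in>B. \<not> adj G u v" "\<forall>u\<in>A. \<forall>v\<in>B. adj G u v"
    "real (card (verts G)) - (80 * real k + 121) * (t / sqrt (real (card (verts G)))) \<le> real (card (A \<union> B))"
    by blast
  have "{e \<in> edges G. e \<subseteq> A \<union> B} = {{a, b} | a b. a \<in> A \<and> b \<in> B}"
  proof (intro equalityI subsetI)
    fix e assume e: "e \<in> {e \<in> edges G. e \<subseteq> A \<union> B}"
    then have "card e = 2" using G by (auto simp: simple_graph_def)
    then obtain a b where ab: "e = {a, b}" by (auto simp: card_2_iff)
    then have "a \<in> A \<union> B" "b \<in> A \<union> B" "adj G a b" using e by auto
    then have "a \<in> A \<and> b \<in> B \<or> b \<in> A \<and> a \<in> B" using AB(3,4) by auto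
    then show "e \<in> {{a, b} | a b. a \<in> A \<and> b \<in> B}" using ab by (auto simp: insert_commute)
  qed (use AB(5) in auto)
  then have "complete_bipartite (induced_subgraph G (A \<union> B))"
    unfolding complete_bipartite_def induced_subgraph_def using AB(1) by auto
  then show ?thesis using AB by blast
qed

section \<open>The asymptotic statement\<close>

lemma complete_bipartite_empty:
  "simple_graph G \<Longrightarrow> complete_bipartite (induced_subgraph G {})"
  by (auto simp: complete_bipartite_def induced_subgraph_def simple_graph_def)

theorem theorem1p3:
  fixes k :: nat and f :: "nat \<Rightarrow> real"
  assumes "k \<ge> 2"
    and "\<And>n. f n \<ge> 0"
    and "f \<in> o(\<lambda>n. real n powr (3 / 2))"
  shows "\<exists>g :: nat \<Rightarrow> real. (\<forall>n. g n \<ge> 0) \<and> g \<in> o(\<lambda>n. real n) \<and>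
    (\<forall>(G :: 'a ugraph) n.
       simple_graph G \<and> card (verts G) = n \<and> maximal_free (cycle_graph (2 * k + 1)) G \<and>
       real (card (edges G)) \<ge> (real n)\<^sup>2 / 4 - f n \<longrightarrow>
       (\<exists>W \<subseteq> verts G. complete_bipartite (induced_subgraph G W) \<and>
          real (card W) \<ge> real n - g n))"
proof -
  have split: "real n powr (3 / 2) = real n * sqrt (real n)" for n
    using powr_add[of "real n" 1 "1 / 2"] by (cases "n = 0") (auto simp: powr_half_sqrt)
  have "eventually (\<lambda>n. norm (f n) \<le> 1 / 160 * norm (real n powr (3 / 2))) at_top"
    by (rule landau_o.smallD[OF assms(3)]) simp
  then obtain N1 where N1: "\<And>n. n \<ge> N1 \<Longrightarrow> norm (f n) \<le> 1 / 160 * norm (real n powr (3 / 2))"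
    by (auto simp: eventually_at_top_linorder)
  \<comment> \<open>From \<open>N\<close> on, both the order of the graph and
    \<open>f n \<le> n^2 / 160\<close> meet the explicit form.\<close>
  define N where "N = max (max N1 1) (100000 * k)"
  have small: "f n \<le> (real n)\<^sup>2 / 160" if "n \<ge> N" for n
  proof -
    have "sqrt (real n) \<le> real n" using that by (intro real_le_lsqrt) (auto simp: N_def power2_eq_square)
    then have "real n * sqrt (real n) \<le> real n * real n" by (intro mult_left_mono) auto
    moreover have "160 * f n \<le> real n * sqrt (real n)"
      using N1[of n] that assms(2)[of n] split[of n] by (simp add: N_def)
    ultimately show ?thesis unfolding power2_eq_square by linarith
  qed
  \<comment> \<open>Dividing by \<open>sqrt n\<close> turns \<open>o(n powr (3 / 2))\<close> into
    \<open>o(n)\<close>.\<close>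
  define h where "h n = (80 * real k + 121) * (f n / sqrt (real n))" for n
  \<comment> \<open>Below \<open>N\<close> the value \<open>n\<close> lets the empty
    \<open>W\<close> serve.\<close>
  define g where "g n = (if n < N then real n else h n)" for n
  have "h \<in> o(\<lambda>n. real n)"
  proof -
    have "(\<lambda>n. f n / sqrt (real n)) \<in> o(\<lambda>n. (real n * sqrt (real n)) / sqrt (real n))"
      using assms(3) unfolding split
      by (intro landau_o.small.divide_right) (auto simp: eventually_at_top_linorder intro!: exI[of _ 1])
    also have "(\<lambda>n. (real n * sqrt (real n)) / sqrt (real n)) = (\<lambda>n. real n)" by auto
    finally have "(\<lambda>n. f n / sqrt (real n)) \<in> o(\<lambda>n. real n)" .
    moreover have "80 * real k + 121 \<noteq> 0" using of_nat_0_le_iff[of k, where 'a = real] by linarith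
    ultimately show ?thesis unfolding h_def by (subst landau_o.small.cmult_in_iff)
  qed
  moreover have "eventually (\<lambda>n. g n = h n) at_top"
    using eventually_ge_at_top[of N] by eventually_elim (simp add: g_def)
  ultimately have "g \<in> o(\<lambda>n. real n)" using landau_o.small.in_cong by blast
  moreover have "g n \<ge> 0" for n using assms(2)[of n] by (simp add: g_def h_def)
  moreover have "\<exists>W \<subseteq> verts G. complete_bipartite (induced_subgraph G W) \<and> real (card W) \<ge> real n - g n"
    if G: "simple_graph G" "card (verts G) = n" "maximal_free (cycle_graph (2 * k + 1)) G"
      "real (card (edges G)) \<ge> (real n)\<^sup>2 / 4 - f n" for G :: "'a ugraph" and n
  proof (cases "n < N")
    case True
    then show ?thesis using complete_bipartite_empty[OF G(1)]
      by (intro exI[of _ "{}"]) (simp add: g_def)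
  next
    case False
    then have "100000 * k \<le> n" "f n \<le> (real n)\<^sup>2 / 160"
      using small[of n] by (simp add: N_def, linarith)
    then show ?thesis
      using maximal_free_induced_complete_bipartite[OF assms(1) G(1,3), of "f n"] G(2,4) assms(2)[of n] False
      by (simp add: g_def h_def)
  qed
  ultimately show ?thesis by blast
qed

end
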